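(* Let $\mathbb{K}$ be an algebraically closed field of characteristic different from $2$. Every $2$-dimensional Jordan algebra over $\mathbb{K}$ is isomorphic either to the trivial algebra (zero multiplication) or to one of the following commutative algebras with basis $\{e_1,e_2\}$, all of which are Jordan algebras: - $J_1$: $e_1e_1=e_1$, $e_1e_2=e_2e_1=e_2$, $e_2e_2=e_2$; - $J_2$: $e_1e_1=e_1$, $e_1e_2=e_2e_1=\frac12(e_1+e_2)$, $e_2e_2=e_2$; - $J_3$: $e_1e_1=e_1$, $e_1e_2=e_2e_1=e_2$, $e_2e_2=0$; - $J_4$: $e_1e_1=e_1$, $e_1e_2=e_2e_1=0$, $e_2e_2=0$; - $J_5$: $e_1e_1=e_2$, $e_1e_2=e_2e_1=0$, $e_2e_2=0$.
   Context: A Jordan algebra over $\mathbb{K}$ is a $\mathbb{K}$-vector space with a bilinear multiplication $(v,w)\mapsto vw$ satisfying $vw=wv$ and $(vw)(vv)=v(w(vv))$ for all $v,w$ (no unit is assumed). Isomorphisms are linear isomorphisms compatible with the multiplications. *)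

theory Defs
  imports "HOL-Analysis.Analysis" "HOL-Computational_Algebra.Polynomial"
begin

locale jordan_algebra = vector_space sc
  for sc :: "'k::field \<Rightarrow> 'v::ab_group_add \<Rightarrow> 'v" +
  fixes mul :: "'v \<Rightarrow> 'v \<Rightarrow> 'v"
  assumes linear_left: "Vector_Spaces.linear sc sc (\<lambda>v. mul v w)"
    and linear_right: "Vector_Spaces.linear sc sc (\<lambda>w. mul v w)"
    and mul_commute: "mul v w = mul w v"
    and jordan_identity: "mul (mul v w) (mul v v) = mul v (mul w (mul v v))"

definition alg_isomorphic ::
  "('k::field \<Rightarrow> 'v::ab_group_add \<Rightarrow> 'v) \<Rightarrow> ('v \<Rightarrow> 'v \<Rightarrow> 'v) \<Rightarrow>
   ('k \<Rightarrow> 'w::ab_group_add \<Rightarrow> 'w) \<Rightarrow> ('w \<Rightarrow> 'w \<Rightarrow> 'w) \<Rightarrow> bool"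
where
  "alg_isomorphic sc mul sc' mul' \<longleftrightarrow>
    (\<exists>f. Vector_Spaces.linear sc sc' f \<and> bij f \<and>
         (\<forall>v w. f (mul v w) = mul' (f v) (f w)))"

definition e1 :: "'k::field ^ 2" where "e1 = axis 1 1"
definition e2 :: "'k::field ^ 2" where "e2 = axis 2 1"

text \<open>The bilinear commutative product on the coordinate plane determined by
  \<open>e1 e1 = a\<close>, \<open>e1 e2 = e2 e1 = b\<close>, \<open>e2 e2 = c\<close>.\<close>

definition table_mult ::
  "'k::field ^ 2 \<Rightarrow> 'k ^ 2 \<Rightarrow> 'k ^ 2 \<Rightarrow> 'k ^ 2 \<Rightarrow> 'k ^ 2 \<Rightarrow> 'k ^ 2"
where
  "table_mult a b c v w =
     (v $ 1 * w $ 1) *s a + (v $ 1 * w $ 2 + v $ 2 * w $ 1) *s b + (v $ 2 * w $ 2) *s c"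

lemma table_mult_basis [simp]:
  "table_mult a b c e1 e1 = a" "table_mult a b c e1 e2 = b"
  "table_mult a b c e2 e1 = b" "table_mult a b c e2 e2 = c"
  by (simp_all add: table_mult_def e1_def e2_def axis_def)

lemma basis_e1_e2:
  "{e1, e2} = (cart_basis :: ('k::field ^ 2) set)" "e1 \<noteq> (e2 :: 'k::field ^ 2)"
  by (auto simp: cart_basis_def UNIV_2 e1_def e2_def axis_eq_axis)

definition J0 :: "'k::field ^ 2 \<Rightarrow> 'k ^ 2 \<Rightarrow> 'k ^ 2" where "J0 v w = 0"
definition J1 :: "'k::field ^ 2 \<Rightarrow> 'k ^ 2 \<Rightarrow> 'k ^ 2" where "J1 = table_mult e1 e2 e2"
definition J2 :: "'k::field ^ 2 \<Rightarrow> 'k ^ 2 \<Rightarrow> 'k ^ 2" where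
  "J2 = table_mult e1 ((1 / 2) *s (e1 + e2)) e2"
definition J3 :: "'k::field ^ 2 \<Rightarrow> 'k ^ 2 \<Rightarrow> 'k ^ 2" where "J3 = table_mult e1 e2 0"
definition J4 :: "'k::field ^ 2 \<Rightarrow> 'k ^ 2 \<Rightarrow> 'k ^ 2" where "J4 = table_mult e1 0 0"
definition J5 :: "'k::field ^ 2 \<Rightarrow> 'k ^ 2 \<Rightarrow> 'k ^ 2" where "J5 = table_mult e2 0 0"

end

theory Submission
  imports Defs
begin

text \<open>Either some \<open>v\<close> is linearly independent of \<open>v\<^sup>2\<close>, or \<open>v\<^sup>2\<close> is a multiple of \<open>v\<close> for
  all \<open>v\<close>. In the first case the Jordan identity with \<open>w = v\<close> shows that the algebra is the
  associative algebra \<open>x K[x] / (x\<^sup>3 - \<beta> x\<^sup>2 - \<alpha> x)\<close>, and the root pattern of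
  \<open>x\<^sup>2 - \<beta> x - \<alpha>\<close> decides between \<open>J1\<close>, \<open>J3\<close>, \<open>J4\<close> and \<open>J5\<close>. In the second case,
  a nonzero multiplication has an idempotent \<open>e\<close>; expanding \<open>(e + u)\<^sup>2\<close> and \<open>(e - u)\<^sup>2\<close>
  for \<open>u\<close> independent of \<open>e\<close> gives \<open>e u = (\<mu> e + u) / 2\<close> where \<open>u\<^sup>2 = \<mu> u\<close>, which is
  \<open>J2\<close>.\<close>

section \<open>Multiplication tables in coordinates, and the Jordan identity for the five
  tables\<close>

lemma eq_vec2_iff: "x = y \<longleftrightarrow> x $ 1 = y $ 1 \<and> x $ 2 = y $ 2" for x y :: "'a ^ 2"
  by (simp add: vec_eq_iff forall_2)

lemma e1_nth [simp]: "e1 $ 1 = 1" "e1 $ 2 = 0"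
  and e2_nth [simp]: "e2 $ 1 = 0" "e2 $ 2 = 1"
  by (simp_all add: e1_def e2_def axis_def)

lemma table_mult_scale:
  "table_mult a b c (k *s x) (l *s y) = (k * l) *s table_mult a b c x y"
  by (simp add: table_mult_def eq_vec2_iff algebra_simps)

lemma jordan_algebra_table_mult:
  fixes a b c :: "'k::field ^ 2"
  assumes "\<And>v w. table_mult a b c (table_mult a b c v w) (table_mult a b c v v) =
                 table_mult a b c v (table_mult a b c w (table_mult a b c v v))"
  shows "jordan_algebra (*s) (table_mult a b c)"
proof
  show "table_mult a b c v w = table_mult a b c w v" for v w
    by (simp add: table_mult_def algebra_simps)
  show "table_mult a b c (table_mult a b c v w) (table_mult a b c v v) =
        table_mult a b c v (table_mult a b c w (table_mult a b c v v))" for v w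
    by (fact assms)
qed (simp_all add: table_mult_def eq_vec2_iff algebra_simps)

lemma jordan_algebras_J:
  fixes J :: "'k::field ^ 2 \<Rightarrow> 'k ^ 2 \<Rightarrow> 'k ^ 2"
  assumes "(2::'k) \<noteq> 0" and J: "J \<in> {J1, J2, J3, J4, J5}"
  shows "jordan_algebra (*s) J"
proof -
  have J2: "jordan_algebra (*s) (J2 :: 'k ^ 2 \<Rightarrow> 'k ^ 2 \<Rightarrow> 'k ^ 2)"
    unfolding J2_def
  proof (rule jordan_algebra_table_mult)
    fix v w :: "'k ^ 2"
    define h :: 'k where "h = 1 / 2"
    \<comment> \<open>With \<open>?L\<close> the coordinate sum, the product of \<open>J2\<close> is
      xy = (L(x) y + L(y) x)/2. Then L is multiplicative, vv = L(v) v and w(vv) = L(v) vw, which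
      makes both sides of the Jordan identity agree.\<close>
    let ?L = "\<lambda>x :: 'k ^ 2. x $ 1 + x $ 2" and ?m = "table_mult e1 (h *s (e1 + e2)) e2"
    have h2: "h * (2 * a) = a" for a
      using assms(1) by (simp add: h_def)
    have hh: "h * a + h * a = a" for a
      using h2[of a] by (simp only: mult_2 distrib_left)
    have m: "?m x y = h *s (?L x *s y + ?L y *s x)" for x y
      using hh[of "x $ 1 * y $ 1"] hh[of "x $ 2 * y $ 2"]
      by (simp add: table_mult_def eq_vec2_iff algebra_simps)
    have sq: "?m v v = ?L v *s v"
      by (simp only: m) (simp add: eq_vec2_iff distrib_left h2)
    have L: "?L (?m x y) = ?L x * ?L y" for x y
      using hh[of "?L x * ?L y"] by (simp only: m) (simp add: algebra_simps)
    have "?m (?m v w) (?m v v) = h *s ((?L v * ?L w) *s (?L v *s v) + (?L v * ?L v) *s ?m v w)"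
      by (simp only: m[of "?m v w"] L) (simp only: sq)
    also have "\<dots> = h *s (?L v *s ?m w (?m v v) + (?L w * (?L v * ?L v)) *s v)"
      by (simp only: m[of w "?m v v"] L) (simp only: sq, simp only: m[of v w], simp add: eq_vec2_iff algebra_simps)
    also have "\<dots> = ?m v (?m w (?m v v))"
      by (simp only: m[of v "?m w (?m v v)"] L)
    finally show "table_mult e1 ((1 / 2) *s (e1 + e2)) e2
            (table_mult e1 ((1 / 2) *s (e1 + e2)) e2 v w)
            (table_mult e1 ((1 / 2) *s (e1 + e2)) e2 v v)
          = table_mult e1 ((1 / 2) *s (e1 + e2)) e2 v
              (table_mult e1 ((1 / 2) *s (e1 + e2)) e2 w
                (table_mult e1 ((1 / 2) *s (e1 + e2)) e2 v v))"
      unfolding h_def .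
  qed
  \<comment> \<open>These four tables are associative and their entries involve no halves, so
    comparing coordinates suffices.\<close>
  have "jordan_algebra (*s) (J1 :: 'k ^ 2 \<Rightarrow> 'k ^ 2 \<Rightarrow> 'k ^ 2)"
       "jordan_algebra (*s) (J3 :: 'k ^ 2 \<Rightarrow> 'k ^ 2 \<Rightarrow> 'k ^ 2)"
       "jordan_algebra (*s) (J4 :: 'k ^ 2 \<Rightarrow> 'k ^ 2 \<Rightarrow> 'k ^ 2)"
       "jordan_algebra (*s) (J5 :: 'k ^ 2 \<Rightarrow> 'k ^ 2 \<Rightarrow> 'k ^ 2)"
    unfolding J1_def J3_def J4_def J5_def
    by (rule jordan_algebra_table_mult; simp add: table_mult_def eq_vec2_iff algebra_simps)+
  with J2 J show ?thesis
    by auto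
qed

section \<open>Bases of a plane as bijective coordinate maps\<close>

text \<open>Bijectivity of \<open>comb a b\<close> encodes that \<open>a\<close>, \<open>b\<close>
  form a basis; the inverse map then serves as the isomorphism onto a table algebra.\<close>

definition (in vector_space) comb :: "'b \<Rightarrow> 'b \<Rightarrow> 'a ^ 2 \<Rightarrow> 'b"
  where "comb a b z = scale (z $ 1) a + scale (z $ 2) b"

context vector_space
begin

lemma comb_add: "comb a b (x + y) = comb a b x + comb a b y"
  by (simp add: comb_def scale_left_distrib)

lemma comb_scale: "comb a b (vector_scalar_mult c x) = scale c (comb a b x)"
  by (simp add: comb_def scale_right_distrib)

lemma comb_e [simp]: "comb a b e1 = a" "comb a b e2 = b"
  by (simp_all add: comb_def)

lemma comb_comb: "comb (comb a b x) (comb a b y) z = comb a b (vector_scalar_mult (z $ 1) x + vector_scalar_mult (z $ 2) y)"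
  by (simp add: comb_add comb_scale) (simp add: comb_def)

lemma bij_comb_comb:
  assumes "bij (comb a b)" and det: "x $ 1 * y $ 2 - x $ 2 * y $ 1 \<noteq> 0"
  shows "bij (comb (comb a b x) (comb a b y))"
proof -
  define d where "d = x $ 1 * y $ 2 - x $ 2 * y $ 1"
  have "d \<noteq> 0"
    using det by (simp add: d_def)
  define h :: "'a ^ 2 \<Rightarrow> 'a ^ 2" where "h = (\<lambda>z. vector_scalar_mult (z $ 1) x + vector_scalar_mult (z $ 2) y)"
  \<comment> \<open>Cramer's rule for the matrix with columns \<open>x\<close> and
    \<open>y\<close>.\<close>
  define h' :: "'a ^ 2 \<Rightarrow> 'a ^ 2" where "h' = (\<lambda>z.
     vector [(z $ 1 * y $ 2 - z $ 2 * y $ 1) / d, (z $ 2 * x $ 1 - z $ 1 * x $ 2) / d])"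
  have 1: "h' (h z) = z" for z
  proof -
    have "z $ 1 * d = (h z) $ 1 * y $ 2 - (h z) $ 2 * y $ 1"
         "z $ 2 * d = (h z) $ 2 * x $ 1 - (h z) $ 1 * x $ 2"
      by (simp_all add: h_def d_def algebra_simps)
    then show ?thesis
      using \<open>d \<noteq> 0\<close> by (simp add: h'_def eq_vec2_iff field_simps)
  qed
  have 2: "h (h' z) = z" for z
  proof -
    have "(z $ 1 * y $ 2 - z $ 2 * y $ 1) * x $ 1 + (z $ 2 * x $ 1 - z $ 1 * x $ 2) * y $ 1 = z $ 1 * d"
         "(z $ 1 * y $ 2 - z $ 2 * y $ 1) * x $ 2 + (z $ 2 * x $ 1 - z $ 1 * x $ 2) * y $ 2 = z $ 2 * d"
      by (simp_all add: d_def algebra_simps)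
    then show ?thesis
      using \<open>d \<noteq> 0\<close> by (simp add: h_def h'_def eq_vec2_iff flip: add_divide_distrib)
  qed
  have "bij h"
    using 1 2 by (intro o_bij[of h']) auto
  then have "bij (comb a b \<circ> h)"
    using assms(1) by (rule bij_comp)
  also have "comb a b \<circ> h = comb (comb a b x) (comb a b y)"
    by (auto simp: comb_comb h_def)
  finally show ?thesis .
qed

lemma bij_comb:
  assumes dim: "dim UNIV = 2" and "a \<noteq> 0" and b: "b \<notin> span {a}"
  shows "bij (comb a b)"
proof -
  obtain B where B: "independent B" "span B = UNIV" "card B = 2"
    using basis_exists[of UNIV] dim by (metis subset_antisym subset_UNIV)
  \<comment> \<open>\<open>card\<close> of an infinite set is 0, so cardinality 2 forces finiteness
    and opens the finite-dimensional theory.\<close>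
  then have "finite B"
    by (simp add: card_ge_0_finite)
  interpret fd: finite_dimensional_vector_space scale B
    by unfold_locales (use B \<open>finite B\<close> in auto)
  have ab: "a \<noteq> b"
    using b by (auto intro: span_base)
  have ind: "independent {b, a}"
    using b \<open>a \<noteq> 0\<close> ab by (subst independent_insert) auto
  have "UNIV \<subseteq> span {b, a}"
    by (rule fd.card_ge_dim_independent) (use ind dim ab in auto)
  have "x \<in> range (comb a b)" for x
  proof -
    have "x \<in> span {b, a}"
      using \<open>UNIV \<subseteq> span {b, a}\<close> by auto
    then obtain k l where "x - scale k b = scale l a"
      by (auto simp: span_insert span_singleton)
    then have "x = comb a b (vector [l, k])"
      by (simp add: comb_def algebra_simps)
    then show ?thesis
      by auto
  qed
  moreover have "inj (comb a b)"
  proof (rule injI)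
    fix x y
    assume "comb a b x = comb a b y"
    then have eq: "scale (x $ 2 - y $ 2) b = scale (y $ 1 - x $ 1) a"
      by (simp add: comb_def algebra_simps)
    have "x $ 2 = y $ 2"
    proof (rule ccontr)
      assume "x $ 2 \<noteq> y $ 2"
      with eq have "b = scale (inverse (x $ 2 - y $ 2) * (y $ 1 - x $ 1)) a"
        by (metis right_minus_eq scale_scale left_inverse scale_one)
      with b show False
        by (auto simp: span_singleton)
    qed
    with eq \<open>a \<noteq> 0\<close> show "x = y"
      by (simp add: eq_vec2_iff)
  qed
  ultimately show ?thesis
    by (auto simp: bij_def)
qed

end

section \<open>Recognising an algebra by its table in a suitable basis\<close>

context jordan_algebra
begin

sublocale mul_left: Vector_Spaces.linear sc sc "\<lambda>v. mul v w" for w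
  by (fact linear_left)

sublocale mul_right: Vector_Spaces.linear sc sc "mul v" for v
  by (fact linear_right)

lemma mul_comb:
  assumes "mul a a = comb a b p" "mul a b = comb a b q" "mul b b = comb a b r"
  shows "mul (comb a b x) (comb a b y) = comb a b (table_mult p q r x y)"
proof -
  have "mul (comb a b x) (comb a b y) =
      sc (x $ 1 * y $ 1) (mul a a) + sc (x $ 1 * y $ 2 + x $ 2 * y $ 1) (mul a b)
      + sc (x $ 2 * y $ 2) (mul b b)"
    by (simp add: comb_def mul_left.add mul_left.scale mul_right.add mul_right.scale
        mul_commute[of b a] scale_right_distrib scale_left_distrib mult.commute add_ac)
  then show ?thesis
    by (simp only: table_mult_def comb_add comb_scale assms)
qed

lemma alg_isomorphic_table_mult:
  assumes "bij (comb a b)"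
    and "mul a a = comb a b p" "mul a b = comb a b q" "mul b b = comb a b r"
  shows "alg_isomorphic sc mul (*s) (table_mult p q r)"
proof -
  let ?f = "inv (comb a b)"
  have fg [simp]: "?f (comb a b x) = x" for x
    using assms(1) by (simp add: bij_is_inj)
  have gf: "\<exists>x. v = comb a b x" for v
    using assms(1) by (metis bij_pointE)
  have "?f (v + w) = ?f v + ?f w" for v w
    using gf[of v] gf[of w] by (auto simp flip: comb_add)
  moreover have "?f (sc c v) = c *s ?f v" for c v
    using gf[of v] by (auto simp flip: comb_scale)
  ultimately have "Vector_Spaces.linear sc (*s) ?f"
    by unfold_locales (auto simp: vec.scale_right_distrib vec.scale_left_distrib)
  moreover have "?f (mul v w) = table_mult p q r (?f v) (?f w)" for v w
    using gf[of v] gf[of w] by (auto simp: mul_comb[OF assms(2-4)])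
  ultimately show ?thesis
    using assms(1) by (auto simp: alg_isomorphic_def intro!: bij_imp_bij_inv)
qed

text \<open>Reduces each case of the classification to arithmetic in the coordinate plane: the new
  basis is given by its coordinates \<open>x\<close>, \<open>y\<close> in the old one, and a nonzero
  determinant replaces bijectivity.\<close>

lemma alg_isomorphic_change_basis:
  assumes bij: "bij (comb a b)"
    and tab: "mul a a = comb a b p" "mul a b = comb a b q" "mul b b = comb a b r"
    and det: "x $ 1 * y $ 2 - x $ 2 * y $ 1 \<noteq> 0"
    and new: "table_mult p q r x x = p' $ 1 *s x + p' $ 2 *s y"
      "table_mult p q r x y = q' $ 1 *s x + q' $ 2 *s y"
      "table_mult p q r y y = r' $ 1 *s x + r' $ 2 *s y"
  shows "alg_isomorphic sc mul (*s) (table_mult p' q' r')"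
  by (rule alg_isomorphic_table_mult[OF bij_comb_comb[OF bij det]])
    (simp_all add: mul_comb[OF tab] new comb_comb)

lemma ex_not_in_span_singleton:
  assumes "dim UNIV = 2"
  shows "\<exists>u. u \<notin> span {e}"
proof (rule ccontr)
  assume "\<not> ?thesis"
  then have "UNIV \<subseteq> span {e}"
    by auto
  then have "dim UNIV \<le> card {e}"
    by (rule dim_le_card) simp
  with assms show False
    by simp
qed

section \<open>The three cases of the classification\<close>

lemma alg_isomorphic_square_independent:
  assumes dim: "dim UNIV = 2" and v: "mul v v \<notin> span {v}"
    and root: "\<And>\<alpha> \<beta> :: 'k. \<exists>t. t * t = \<beta> * t + \<alpha>"
  shows "\<exists>J \<in> {J1, J3, J4, J5}. alg_isomorphic sc mul (*s) J"
proof -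
  define w where "w = mul v v"
  have "v \<noteq> 0"
    using v mul_left.zero span_zero by metis
  have bij: "bij (comb v w)"
    unfolding w_def by (rule bij_comb[OF dim \<open>v \<noteq> 0\<close> v])
  obtain q where vw: "mul v w = comb v w q"
    using bij by (metis bij_pointE)
  \<comment> \<open>\<rho> and \<sigma> are the two roots of t^2 - q2 t - q1, where v^3 = q1 v + q2
    v^2. Below, a coordinate vector [a, b] stands for the polynomial a t + b t^2 modulo t (t -
    \<rho>)(t - \<sigma>).\<close>
  obtain \<rho> where \<rho>: "\<rho> * \<rho> = q $ 2 * \<rho> + q $ 1"
    using root by blast
  define \<sigma> where "\<sigma> = q $ 2 - \<rho>"
  have q: "q $ 1 = - (\<rho> * \<sigma>)" "q $ 2 = \<rho> + \<sigma>"
    using \<rho> by (simp_all add: \<sigma>_def algebra_simps)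
  define r where "r = q $ 1 *s e2 + q $ 2 *s q"
  have vv: "mul v v = comb v w e2"
    by (simp add: w_def)
  have "mul w w = mul v (mul v w)"
    using jordan_identity[of v v] by (simp add: w_def)
  also have "\<dots> = sc (q $ 1) (mul v v) + sc (q $ 2) (mul v w)"
    by (subst vw) (simp add: comb_def mul_right.add mul_right.scale w_def)
  also have "\<dots> = comb v w r"
    by (simp add: r_def comb_add comb_scale w_def vw[unfolded w_def])
  finally have ww: "mul w w = comb v w r" .
  note iso = alg_isomorphic_change_basis[OF bij vv vw ww]
  consider "\<rho> * \<sigma> \<noteq> 0" "\<rho> \<noteq> \<sigma>" | "\<rho> * \<sigma> \<noteq> 0" "\<rho> = \<sigma>" | "\<rho> * \<sigma> = 0" "\<rho> + \<sigma> \<noteq> 0"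
    | "\<rho> * \<sigma> = 0" "\<rho> + \<sigma> = 0"
    by blast
  then show ?thesis
  proof cases
    case 1
    define X Y :: "'k ^ 2" where "X = vector [\<rho> + \<sigma>, - 1]" and "Y = vector [- \<rho>, 1]"
    have XY: "table_mult e2 q r X X = (\<rho> * \<sigma>) *s X" "table_mult e2 q r X Y = (\<rho> * \<sigma>) *s Y"
      "table_mult e2 q r Y Y = (\<sigma> * (\<sigma> - \<rho>)) *s Y"
      by (simp_all add: X_def Y_def table_mult_def eq_vec2_iff r_def q algebra_simps)
    \<comment> \<open>the unit and the idempotent that evaluates to 0 at \<open>\<rho>\<close> and to 1 at \<open>\<sigma>\<close>\<close>
    have "alg_isomorphic sc mul (*s) J1"
      unfolding J1_def
      by (rule iso[where x = "(1 / (\<rho> * \<sigma>)) *s X" and y = "(1 / (\<sigma> * (\<sigma> - \<rho>))) *s Y"])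
        (use 1 in \<open>simp_all add: table_mult_scale XY\<close>, simp add: X_def Y_def field_simps)
    then show ?thesis by simp
  next
    case 2
    have "alg_isomorphic sc mul (*s) J3"
      unfolding J3_def
      \<comment> \<open>The first vector is 1 - (1 - t/\<rho>)^2, the unit; the second is t (t -
        \<rho>), whose square vanishes modulo t (t - \<rho>)^2.\<close>
      by (rule iso[where x = "vector [2 / \<rho>, - 1 / (\<rho> * \<rho>)]" and y = "vector [- \<rho>, 1]"])
        (use 2 in \<open>simp_all add: table_mult_def eq_vec2_iff r_def q field_simps\<close>)
    then show ?thesis by simp
  next
    case 3
    then have *: "q $ 1 = 0" "q $ 2 \<noteq> 0" by (simp_all add: q)
    have "alg_isomorphic sc mul (*s) J4"
      unfolding J4_def
      \<comment> \<open>Here v^3 = s v^2 with s = \<open>q $ 2\<close>, so v^2/s^2 is idempotent,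
        and v - v^2/s is annihilated by v^2 and has square zero.\<close>
      by (rule iso[where x = "vector [0, 1 / (q $ 2 * q $ 2)]" and y = "vector [1, - 1 / q $ 2]"])
        (use * in \<open>simp_all add: table_mult_def eq_vec2_iff r_def field_simps\<close>)
    then show ?thesis by simp
  next
    case 4
    then have "q = 0" "r = 0" by (simp_all add: q r_def eq_vec2_iff)
    then have "alg_isomorphic sc mul (*s) J5"
      unfolding J5_def using alg_isomorphic_table_mult[OF bij vv vw ww] by simp
    then show ?thesis by simp
  qed
qed

lemma alg_isomorphic_square_dependent:
  assumes dim: "dim UNIV = 2" and sq: "\<And>v. mul v v \<in> span {v}"
    and two: "(2::'k) \<noteq> 0" and nonzero: "mul v v \<noteq> 0"
  shows "alg_isomorphic sc mul (*s) J2"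
proof -
  have sq': "\<exists>k. mul x x = sc k x" for x
    using sq[of x] by (auto simp: span_singleton)
  then obtain k where k: "mul v v = sc k v"
    by blast
  \<comment> \<open>Dividing \<open>v\<close> by the factor in v^2 = k v makes it
    idempotent.\<close>
  define e where "e = sc (inverse k) v"
  have "k \<noteq> 0" "v \<noteq> 0"
    using nonzero k by auto
  then have e: "mul e e = e" "e \<noteq> 0"
    by (simp_all add: e_def mul_left.scale mul_right.scale k)
  obtain u where u: "u \<notin> span {e}"
    using ex_not_in_span_singleton[OF dim] by blast
  have bij: "bij (comb e u)"
    by (rule bij_comb[OF dim e(2) u])
  have inj: "comb e u x = comb e u y \<longleftrightarrow> x = y" for x y
    using bij by (auto dest: bij_is_inj injD)
  obtain q where q: "mul e u = comb e u q"
    using bij by (metis bij_pointE)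
  obtain \<mu> where "mul u u = sc \<mu> u"
    using sq' by blast
  then have \<mu>: "mul u u = comb e u (\<mu> *s e2)"
    by (simp add: comb_scale)
  have ee: "mul e e = comb e u e1"
    by (simp add: e)
  note tab = ee q \<mu>
  have *: "\<exists>c. table_mult e1 q (\<mu> *s e2) x x = c *s x" for x
    using sq'[of "comb e u x"] by (simp add: mul_comb[OF tab] inj flip: comb_scale)
  \<comment> \<open>The squares of e + u and e - u are c (e + u) and d (e - u). Eliminating
    \<open>c\<close> and \<open>d\<close> from the four coordinate equations determines e u.\<close>
  obtain c where c: "table_mult e1 q (\<mu> *s e2) (vector [1, 1]) (vector [1, 1]) = c *s vector [1, 1]"
    using * by blast
  have plus: "1 + 2 * q $ 1 = c" "\<mu> + 2 * q $ 2 = c"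
    using c by (simp_all add: table_mult_def eq_vec2_iff algebra_simps)
  obtain d where d: "table_mult e1 q (\<mu> *s e2) (vector [1, - 1]) (vector [1, - 1]) = d *s vector [1, - 1]"
    using * by blast
  have minus: "1 - 2 * q $ 1 = d" "\<mu> - 2 * q $ 2 = - d"
    using d by (simp_all add: table_mult_def eq_vec2_iff algebra_simps)
  have "2 * (2 * q $ 2) = (\<mu> + 2 * q $ 2) - (\<mu> - 2 * q $ 2)"
    by simp
  also have "\<dots> = (1 + 2 * q $ 1) + (1 - 2 * q $ 1)"
    by (simp only: plus minus) simp
  finally have "2 * (2 * q $ 2) = 2 * 1"
    by simp
  moreover have "2 * (2 * q $ 1) = 2 * \<mu>"
  proof -
    have "2 * (2 * q $ 1) = (1 + 2 * q $ 1) - (1 - 2 * q $ 1)"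
      by simp
    also have "\<dots> = (\<mu> + 2 * q $ 2) + (\<mu> - 2 * q $ 2)"
      by (simp only: plus minus) simp
    finally show ?thesis
      by simp
  qed
  ultimately have q2: "2 * q $ 2 = 1" "2 * q $ 1 = \<mu>"
    using two by (simp_all only: mult_cancel_left) simp_all
  then have q3: "q $ 2 = 1 / 2" "q $ 1 = \<mu> / 2"
    using two by (simp_all add: field_simps)
  note iso = alg_isomorphic_change_basis[OF bij tab, where x = e1]
  show ?thesis
  proof (cases "\<mu> = 0")
    case True
    show ?thesis
      unfolding J2_def
      \<comment> \<open>For \<mu> = 0 we have u^2 = 0 and e u = u/2, so e + u is the second
        idempotent; for \<mu> nonzero it is u/\<mu>.\<close>
      by (rule iso[where y = "vector [1, 1]"])
        (use two in \<open>simp_all add: table_mult_def eq_vec2_iff q3 True\<close>)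
  next
    case False
    show ?thesis
      unfolding J2_def
      by (rule iso[where y = "vector [0, 1 / \<mu>]"])
        (use two False in \<open>simp_all add: table_mult_def eq_vec2_iff q3\<close>)
  qed
qed

text \<open>Polarization: (v + w)^2 = v^2 + 2 v w + w^2, so vanishing squares force all products to
  vanish when 2 is invertible.\<close>

lemma alg_isomorphic_zero:
  assumes dim: "dim UNIV = 2" and sq: "\<And>v. mul v v = 0" and two: "(2::'k) \<noteq> 0"
  shows "alg_isomorphic sc mul (*s) J0"
proof -
  have 0: "mul v w = 0" for v w
  proof -
    have "sc 2 (mul v w) = mul v w + mul v w"
      by (metis one_add_one scale_left_distrib scale_one)
    also have "\<dots> = mul (v + w) (v + w)"
      by (simp only: mul_left.add mul_right.add mul_commute[of w v]) (simp add: sq)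
    finally show ?thesis
      using two by (simp add: sq)
  qed
  \<comment> \<open>Lying outside the span of 0 just means being nonzero.\<close>
  obtain a :: 'v where a: "a \<notin> span {0}"
    using ex_not_in_span_singleton[OF dim] by blast
  obtain b where b: "b \<notin> span {a}"
    using ex_not_in_span_singleton[OF dim] by blast
  have "bij (comb a b)"
    using a by (intro bij_comb[OF dim _ b]) (auto simp: span_zero)
  then have "alg_isomorphic sc mul (*s) (table_mult 0 0 0)"
    by (rule alg_isomorphic_table_mult) (simp_all add: 0 comb_def)
  also have "table_mult 0 0 0 = J0"
    by (simp add: fun_eq_iff table_mult_def J0_def)
  finally show ?thesis .
qed

end

section \<open>Facts about the ground field, and assembly of the cases\<close>

lemma two_neq_zero_if_CHAR:
  assumes "CHAR('k::field) \<noteq> 2"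
  shows "(2::'k) \<noteq> 0"
proof
  assume "(2::'k) = 0"
  then have "CHAR('k) dvd 2"
    using of_nat_eq_0_iff_char_dvd[of 2, where ?'a = 'k] by simp
  then have "CHAR('k) = 1 \<or> CHAR('k) = 2"
    using two_is_prime_nat prime_nat_iff by blast
  with assms show False
    by simp
qed

lemma alg_closed_quadratic_root:
  fixes \<alpha> \<beta> :: "'k::alg_closed_field"
  shows "\<exists>t. t * t = \<beta> * t + \<alpha>"
proof -
  have "\<exists>t. poly [:- \<alpha>, - \<beta>, 1:] t = 0"
    by (rule alg_closed_imp_poly_has_root) simp
  then show ?thesis
    by (auto simp: algebra_simps add_eq_0_iff)
qed

theorem mainTheorem6:
  assumes "CHAR('k::alg_closed_field) \<noteq> 2"
  shows "(\<forall>(sc :: 'k \<Rightarrow> 'v::ab_group_add \<Rightarrow> 'v) mul.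
            jordan_algebra sc mul \<and> vector_space.dim sc (UNIV :: 'v set) = 2 \<longrightarrow>
            (\<exists>J \<in> {J0, J1, J2, J3, J4, J5}. alg_isomorphic sc mul (*s) J)) \<and>
         (\<forall>J \<in> {J1, J2, J3, J4, J5}. jordan_algebra ((*s) :: 'k \<Rightarrow> 'k ^ 2 \<Rightarrow> 'k ^ 2) J)"
proof (intro conjI allI impI ballI)
  note two = two_neq_zero_if_CHAR[OF assms]
  fix sc :: "'k \<Rightarrow> 'v \<Rightarrow> 'v" and mul
  assume *: "jordan_algebra sc mul \<and> vector_space.dim sc (UNIV :: 'v set) = 2"
  then interpret jordan_algebra sc mul
    by simp
  have dim: "dim UNIV = 2"
    using * by simp
  consider v where "mul v v \<notin> span {v}" | "\<And>v. mul v v = 0"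
    | v where "\<And>v. mul v v \<in> span {v}" "mul v v \<noteq> 0"
    by blast
  then show "\<exists>J \<in> {J0, J1, J2, J3, J4, J5}. alg_isomorphic sc mul (*s) J"
  proof cases
    case 1
    then show ?thesis
      using alg_isomorphic_square_independent[OF dim _ alg_closed_quadratic_root] by blast
  next
    case 2
    then show ?thesis
      using alg_isomorphic_zero[OF dim _ two] by blast
  next
    case 3
    then show ?thesis
      using alg_isomorphic_square_dependent[OF dim _ two] by blast
  qed
next
  show "jordan_algebra (*s) J" if "J \<in> {J1, J2, J3, J4, J5}" for J :: "'k ^ 2 \<Rightarrow> 'k ^ 2 \<Rightarrow> 'k ^ 2"
    using jordan_algebras_J[OF two_neq_zero_if_CHAR[OF assms] that] .
qed

end
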